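(* Let $G$ be a multiplicative Lie algebra whose Schur multiplier $\tilde M(G)$ is finite, and let $1\to N\to G^*\xrightarrow{\phi}G\to1$ be a stem cover of $G$. Then $\mathcal{Z}^*(G)=\phi(\mathcal{Z}(G^* ))$.
   Context: A multiplicative Lie algebra is a triple $(G,\cdot,\star)$ where $(G,\cdot)$ is a group (not necessarily abelian) and $\star$ is a binary operation on $G$ such that for all $x,y,z\in G$, writing ${}^xy=xyx^{-1}$: (1) $x\star x=1$; (2) $x\star(yz)=(x\star y)\,{}^y(x\star z)$; (3) $(xy)\star z={}^x(y\star z)\,(x\star z)$; (4) $((x\star y)\star{}^yz)((y\star z)\star{}^zx)((z\star x)\star{}^xy)=1$; (5) ${}^z(x\star y)={}^zx\star{}^zy$. An ideal is a normal subgroup $H$ with $x\star y\in H$ for all $x\in G$, $y\in H$. Homomorphisms are group homomorphisms preserving $\star$. For ideals $A,B$ of a multiplicative Lie algebra, at least one of which is the whole algebra, ${}^M[A,B]=(A\star B)[A,B]$, where $A\star B$ (resp. $[A,B]$) is the subgroup generated by all $a\star b$ (resp. $[a,b]=aba^{-1}b^{-1}$), $a\in A$, $b\in B$; it is an ideal. $Z(G)$ is the group center, $LZ(G)=\{x\in G: x\star y=1\ \forall y\in G\}$, $\mathcal{Z}(G)=LZ(G)\cap Z(G)$. The Schur multiplier of $G$ is $\tilde M(G)=({}^M[F,F]\cap R)/{}^M[R,F]$ for any free presentation $1\to R\to F\to G\to1$ (short exact sequence of multiplicative Lie algebras with $F$ a free multiplicative Lie algebra on a set); it is independent of the presentation up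 to isomorphism. A central extension $1\to N\to E\xrightarrow{\phi}G\to1$ is a short exact sequence of multiplicative Lie algebras with $N\subseteq\mathcal{Z}(E)$. It is a stem extension if $N\subseteq{}^M[E,E]$, and a stem cover if in addition $N\cong\tilde M(G)$. $\mathcal{Z}^*(G)$ is the intersection of $\phi(\mathcal{Z}(E))$ over all central extensions $1\to\ker\phi\to E\xrightarrow{\phi}G\to1$ of $G$. *)

theory Defs
  imports "HOL-Algebra.Generated_Groups"
begin

section \<open>Multiplicative Lie algebras\<close>

record 'a mult_lie = "'a monoid" +
  star :: "'a \<Rightarrow> 'a \<Rightarrow> 'a" (infixl \<open>\<star>\<index>\<close> 70)

definition conj_by :: "('a, 'm) monoid_scheme \<Rightarrow> 'a \<Rightarrow> 'a \<Rightarrow> 'a" where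
  "conj_by G x y = x \<otimes>\<^bsub>G\<^esub> y \<otimes>\<^bsub>G\<^esub> inv\<^bsub>G\<^esub> x"

definition commutator :: "('a, 'm) monoid_scheme \<Rightarrow> 'a \<Rightarrow> 'a \<Rightarrow> 'a" where
  "commutator G x y = x \<otimes>\<^bsub>G\<^esub> y \<otimes>\<^bsub>G\<^esub> inv\<^bsub>G\<^esub> x \<otimes>\<^bsub>G\<^esub> inv\<^bsub>G\<^esub> y"

locale mult_lie_algebra = group G for G :: "('a, 'm) mult_lie_scheme" (structure) +
  assumes star_closed:
      "\<lbrakk>x \<in> carrier G; y \<in> carrier G\<rbrakk> \<Longrightarrow> x \<star> y \<in> carrier G"
    and star_self:
      "x \<in> carrier G \<Longrightarrow> x \<star> x = \<one>"
    and star_mult_right: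
      "\<lbrakk>x \<in> carrier G; y \<in> carrier G; z \<in> carrier G\<rbrakk>
        \<Longrightarrow> x \<star> (y \<otimes> z) = (x \<star> y) \<otimes> conj_by G y (x \<star> z)"
    and star_mult_left:
      "\<lbrakk>x \<in> carrier G; y \<in> carrier G; z \<in> carrier G\<rbrakk>
        \<Longrightarrow> (x \<otimes> y) \<star> z = conj_by G x (y \<star> z) \<otimes> (x \<star> z)"
    and star_jacobi:
      "\<lbrakk>x \<in> carrier G; y \<in> carrier G; z \<in> carrier G\<rbrakk>
        \<Longrightarrow> ((x \<star> y) \<star> conj_by G y z) \<otimes> ((y \<star> z) \<star> conj_by G z x)
              \<otimes> ((z \<star> x) \<star> conj_by G x y) = \<one>"
    and star_conj:
      "\<lbrakk>x \<in> carrier G; y \<in> carrier G; z \<in> carrier G\<rbrakk>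
        \<Longrightarrow> conj_by G z (x \<star> y) = conj_by G z x \<star> conj_by G z y"

definition mla_hom :: "('a, 'm) mult_lie_scheme \<Rightarrow> ('b, 'n) mult_lie_scheme \<Rightarrow> ('a \<Rightarrow> 'b) set" where
  "mla_hom G H = {h \<in> hom G H.
     \<forall>x\<in>carrier G. \<forall>y\<in>carrier G. h (x \<star>\<^bsub>G\<^esub> y) = h x \<star>\<^bsub>H\<^esub> h y}"

definition mla_iso :: "('a, 'm) mult_lie_scheme \<Rightarrow> ('b, 'n) mult_lie_scheme \<Rightarrow> bool" where
  "mla_iso G H \<longleftrightarrow> (\<exists>h\<in>mla_hom G H. bij_betw h (carrier G) (carrier H))"

definition mla_ideal :: "'a set \<Rightarrow> ('a, 'm) mult_lie_scheme \<Rightarrow> bool" where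
  "mla_ideal H G \<longleftrightarrow> H \<lhd> G \<and> (\<forall>x\<in>carrier G. \<forall>y\<in>H. x \<star>\<^bsub>G\<^esub> y \<in> H)"

text \<open>For an ideal \<open>H\<close> the union defining the star of two cosets is the single coset
  \<open>H #> (a \<star> b)\<close>, for any representatives \<open>a\<close>, \<open>b\<close>.\<close>

definition mla_quotient :: "('a, 'm) mult_lie_scheme \<Rightarrow> 'a set \<Rightarrow> 'a set mult_lie" where
  "mla_quotient G H =
     \<lparr>carrier = rcosets\<^bsub>G\<^esub> H, monoid.mult = set_mult G, one = H,
      star = (\<lambda>A B. \<Union>a\<in>A. \<Union>b\<in>B. H #>\<^bsub>G\<^esub> (a \<star>\<^bsub>G\<^esub> b))\<rparr>"

definition star_subgroup :: "('a, 'm) mult_lie_scheme \<Rightarrow> 'a set \<Rightarrow> 'a set \<Rightarrow> 'a set" where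
  "star_subgroup G A B = generate G {a \<star>\<^bsub>G\<^esub> b | a b. a \<in> A \<and> b \<in> B}"

definition comm_subgroup :: "('a, 'm) mult_lie_scheme \<Rightarrow> 'a set \<Rightarrow> 'a set \<Rightarrow> 'a set" where
  "comm_subgroup G A B = generate G {commutator G a b | a b. a \<in> A \<and> b \<in> B}"

definition M_comm :: "('a, 'm) mult_lie_scheme \<Rightarrow> 'a set \<Rightarrow> 'a set \<Rightarrow> 'a set" where
  "M_comm G A B = star_subgroup G A B <#>\<^bsub>G\<^esub> comm_subgroup G A B"

definition group_center :: "('a, 'm) mult_lie_scheme \<Rightarrow> 'a set" where
  "group_center G = {x \<in> carrier G. \<forall>y\<in>carrier G. x \<otimes>\<^bsub>G\<^esub> y = y \<otimes>\<^bsub>G\<^esub> x}"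

definition lie_center :: "('a, 'm) mult_lie_scheme \<Rightarrow> 'a set" where
  "lie_center G = {x \<in> carrier G. \<forall>y\<in>carrier G. x \<star>\<^bsub>G\<^esub> y = \<one>\<^bsub>G\<^esub>}"

definition mla_center :: "('a, 'm) mult_lie_scheme \<Rightarrow> 'a set" where
  "mla_center G = lie_center G \<inter> group_center G"


section \<open>Free multiplicative Lie algebras\<close>

text \<open>The free multiplicative Lie algebra on a set is constructed as a term algebra modulo
  the laws, so that its universal property holds for targets of every type.\<close>

datatype 'x mla_term =
    TGen 'x | TOne | TMult "'x mla_term" "'x mla_term"
  | TInv "'x mla_term" | TStar "'x mla_term" "'x mla_term"

abbreviation TConj :: "'x mla_term \<Rightarrow> 'x mla_term \<Rightarrow> 'x mla_term" where
  "TConj x y \<equiv> TMult (TMult x y) (TInv x)"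

inductive mla_eq :: "'x mla_term \<Rightarrow> 'x mla_term \<Rightarrow> bool" where
  refl: "mla_eq t t"
| sym: "mla_eq s t \<Longrightarrow> mla_eq t s"
| trans: "mla_eq s t \<Longrightarrow> mla_eq t u \<Longrightarrow> mla_eq s u"
| cong_mult: "mla_eq s s' \<Longrightarrow> mla_eq t t' \<Longrightarrow> mla_eq (TMult s t) (TMult s' t')"
| cong_inv: "mla_eq s s' \<Longrightarrow> mla_eq (TInv s) (TInv s')"
| cong_star: "mla_eq s s' \<Longrightarrow> mla_eq t t' \<Longrightarrow> mla_eq (TStar s t) (TStar s' t')"
| assoc: "mla_eq (TMult (TMult x y) z) (TMult x (TMult y z))"
| l_one: "mla_eq (TMult TOne x) x"
| l_inv: "mla_eq (TMult (TInv x) x) TOne"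
| star_self: "mla_eq (TStar x x) TOne"
| star_mult_right:
    "mla_eq (TStar x (TMult y z)) (TMult (TStar x y) (TConj y (TStar x z)))"
| star_mult_left:
    "mla_eq (TStar (TMult x y) z) (TMult (TConj x (TStar y z)) (TStar x z))"
| star_jacobi:
    "mla_eq (TMult (TMult (TStar (TStar x y) (TConj y z)) (TStar (TStar y z) (TConj z x)))
               (TStar (TStar z x) (TConj x y))) TOne"
| star_conj:
    "mla_eq (TConj z (TStar x y)) (TStar (TConj z x) (TConj z y))"

definition mla_terms :: "'x set \<Rightarrow> 'x mla_term set" where
  "mla_terms X = {t. set_mla_term t \<subseteq> X}"

definition mla_class :: "'x set \<Rightarrow> 'x mla_term \<Rightarrow> 'x mla_term set" where
  "mla_class X t = {s \<in> mla_terms X. mla_eq s t}"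

definition free_mla :: "'x set \<Rightarrow> 'x mla_term set mult_lie" where
  "free_mla X =
     \<lparr>carrier = mla_class X ` mla_terms X,
      monoid.mult = (\<lambda>A B. \<Union>a\<in>A. \<Union>b\<in>B. mla_class X (TMult a b)),
      one = mla_class X TOne,
      star = (\<lambda>A B. \<Union>a\<in>A. \<Union>b\<in>B. mla_class X (TStar a b))\<rparr>"

lemma mla_terms_simps [simp]:
  "TGen x \<in> mla_terms X \<longleftrightarrow> x \<in> X"
  "TOne \<in> mla_terms X"
  "TMult s t \<in> mla_terms X \<longleftrightarrow> s \<in> mla_terms X \<and> t \<in> mla_terms X"
  "TInv s \<in> mla_terms X \<longleftrightarrow> s \<in> mla_terms X"
  "TStar s t \<in> mla_terms X \<longleftrightarrow> s \<in> mla_terms X \<and> t \<in> mla_terms X"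
  by (auto simp: mla_terms_def)

lemma mla_class_eq: "mla_eq s t \<Longrightarrow> mla_class X s = mla_class X t"
  unfolding mla_class_def by (metis mla_eq.sym mla_eq.trans)

lemma mla_class_eqD: "s \<in> mla_terms X \<Longrightarrow> mla_class X s = mla_class X t \<Longrightarrow> mla_eq s t"
  unfolding mla_class_def using mla_eq.refl [of s] by blast

lemma mla_class_self: "t \<in> mla_terms X \<Longrightarrow> t \<in> mla_class X t"
  by (simp add: mla_class_def mla_eq.refl)

lemma free_mla_simps:
  "carrier (free_mla X) = mla_class X ` mla_terms X"
  "\<one>\<^bsub>free_mla X\<^esub> = mla_class X TOne"
  by (simp_all add: free_mla_def)

lemma free_mla_ops:
  assumes "s \<in> mla_terms X" "t \<in> mla_terms X"
  shows "mla_class X s \<otimes>\<^bsub>free_mla X\<^esub> mla_class X t = mla_class X (TMult s t)"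
    and "mla_class X s \<star>\<^bsub>free_mla X\<^esub> mla_class X t = mla_class X (TStar s t)"
proof -
  have c: "mla_class X (TMult a b) = mla_class X (TMult s t)"
          "mla_class X (TStar a b) = mla_class X (TStar s t)"
    if "a \<in> mla_class X s" "b \<in> mla_class X t" for a b
    using that by (auto simp: mla_class_def [of X s] mla_class_def [of X t]
        intro!: mla_class_eq mla_eq.cong_mult mla_eq.cong_star)
  have UN: "(\<Union>a\<in>A. \<Union>b\<in>B. f a b) = K"
    if "\<And>a b. a \<in> A \<Longrightarrow> b \<in> B \<Longrightarrow> f a b = K" "x \<in> A" "y \<in> B"
    for A B and f :: "'a mla_term \<Rightarrow> 'a mla_term \<Rightarrow> 'a mla_term set" and K x y
    using that by blast
  show "mla_class X s \<otimes>\<^bsub>free_mla X\<^esub> mla_class X t = mla_class X (TMult s t)"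
    and "mla_class X s \<star>\<^bsub>free_mla X\<^esub> mla_class X t = mla_class X (TStar s t)"
    unfolding free_mla_def monoid.simps mult_lie.simps
    by (rule UN [OF c(1) mla_class_self [OF assms(1)] mla_class_self [OF assms(2)]], assumption+)
      (rule UN [OF c(2) mla_class_self [OF assms(1)] mla_class_self [OF assms(2)]], assumption+)
qed

lemma free_mla_carrierI: "t \<in> mla_terms X \<Longrightarrow> mla_class X t \<in> carrier (free_mla X)"
  by (simp add: free_mla_simps)

lemma free_mla_carrierE:
  assumes "a \<in> carrier (free_mla X)"
  obtains t where "t \<in> mla_terms X" "a = mla_class X t"
  using assms by (auto simp: free_mla_simps)

lemma free_mla_group: "group (free_mla X)"
proof (rule groupI)
  show "\<one>\<^bsub>free_mla X\<^esub> \<in> carrier (free_mla X)" by (simp add: free_mla_simps)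
next
  fix x y assume "x \<in> carrier (free_mla X)" "y \<in> carrier (free_mla X)"
  then obtain s t where "s \<in> mla_terms X" "t \<in> mla_terms X" "x = mla_class X s" "y = mla_class X t"
    by (metis free_mla_carrierE)
  then show "x \<otimes>\<^bsub>free_mla X\<^esub> y \<in> carrier (free_mla X)"
    by (simp add: free_mla_ops free_mla_carrierI)
next
  fix x y z
  assume "x \<in> carrier (free_mla X)" "y \<in> carrier (free_mla X)" "z \<in> carrier (free_mla X)"
  then obtain s t u where *: "s \<in> mla_terms X" "t \<in> mla_terms X" "u \<in> mla_terms X"
    "x = mla_class X s" "y = mla_class X t" "z = mla_class X u"
    by (metis free_mla_carrierE)
  then show "x \<otimes>\<^bsub>free_mla X\<^esub> y \<otimes>\<^bsub>free_mla X\<^esub> z = x \<otimes>\<^bsub>free_mla X\<^esub> (y \<otimes>\<^bsub>free_mla X\<^esub> z)"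
    by (simp add: free_mla_ops mla_class_eq [OF mla_eq.assoc])
next
  fix x assume "x \<in> carrier (free_mla X)"
  then obtain s where s: "s \<in> mla_terms X" "x = mla_class X s"
    by (rule free_mla_carrierE)
  show "\<one>\<^bsub>free_mla X\<^esub> \<otimes>\<^bsub>free_mla X\<^esub> x = x"
    using s by (simp add: free_mla_ops free_mla_simps mla_class_eq [OF mla_eq.l_one])
  have "mla_class X (TInv s) \<otimes>\<^bsub>free_mla X\<^esub> x = \<one>\<^bsub>free_mla X\<^esub>"
    using s by (simp add: free_mla_ops free_mla_simps mla_class_eq [OF mla_eq.l_inv])
  then show "\<exists>y\<in>carrier (free_mla X). y \<otimes>\<^bsub>free_mla X\<^esub> x = \<one>\<^bsub>free_mla X\<^esub>"
    using s by (intro bexI [of _ "mla_class X (TInv s)"] free_mla_carrierI) simp_all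
qed

lemma free_mla_inv:
  assumes "s \<in> mla_terms X"
  shows "inv\<^bsub>free_mla X\<^esub> (mla_class X s) = mla_class X (TInv s)"
  by (rule group.inv_equality [OF free_mla_group])
    (use assms in \<open>auto simp: free_mla_ops free_mla_simps mla_class_eq [OF mla_eq.l_inv]\<close>)

lemma free_mla_mult_lie_algebra: "mult_lie_algebra (free_mla X)"
proof -
  interpret group "free_mla X" by (rule free_mla_group)
  show ?thesis
    by unfold_locales
      (elim free_mla_carrierE;
       simp add: free_mla_ops free_mla_inv conj_by_def free_mla_carrierI free_mla_simps(2);
       rule mla_class_eq; rule mla_eq.star_self mla_eq.star_mult_right mla_eq.star_mult_left
         mla_eq.star_jacobi mla_eq.star_conj)+
qed

primrec mla_eval :: "('b, 'm) mult_lie_scheme \<Rightarrow> ('x \<Rightarrow> 'b) \<Rightarrow> 'x mla_term \<Rightarrow> 'b" where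
  "mla_eval H f (TGen x) = f x"
| "mla_eval H f TOne = \<one>\<^bsub>H\<^esub>"
| "mla_eval H f (TMult s t) = mla_eval H f s \<otimes>\<^bsub>H\<^esub> mla_eval H f t"
| "mla_eval H f (TInv s) = inv\<^bsub>H\<^esub> mla_eval H f s"
| "mla_eval H f (TStar s t) = mla_eval H f s \<star>\<^bsub>H\<^esub> mla_eval H f t"

lemma mla_eval_closed:
  assumes "mult_lie_algebra H" "t \<in> mla_terms X" "\<And>x. x \<in> X \<Longrightarrow> f x \<in> carrier H"
  shows "mla_eval H f t \<in> carrier H"
proof -
  interpret H: mult_lie_algebra H by fact
  show ?thesis using assms(2) by (induction t) (auto simp: assms(3) H.star_closed)
qed

lemma mla_eval_eq:
  assumes "mult_lie_algebra H" "\<And>x. f x \<in> carrier H" "mla_eq s t"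
  shows "mla_eval H f s = mla_eval H f t"
proof -
  interpret H: mult_lie_algebra H by fact
  have cl: "mla_eval H f t \<in> carrier H" for t
    by (rule mla_eval_closed [OF assms(1), of t UNIV]) (auto simp: mla_terms_def assms(2))
  note [simp] = cl
  show ?thesis using assms(3)
  proof induction
    case (star_mult_right x y z)
    then show ?case using H.star_mult_right by (simp add: conj_by_def)
  next
    case (star_mult_left x y z)
    then show ?case using H.star_mult_left by (simp add: conj_by_def)
  next
    case (star_jacobi x y z)
    then show ?case
      using H.star_jacobi [of "mla_eval H f x" "mla_eval H f y" "mla_eval H f z"]
      by (simp add: conj_by_def)
  next
    case (star_conj z x y)
    then show ?case using H.star_conj by (simp add: conj_by_def)
  qed (simp_all add: H.m_assoc H.star_self)
qed

lemma mla_eval_cong: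
  assumes "t \<in> mla_terms X" "\<And>x. x \<in> X \<Longrightarrow> f x = g x"
  shows "mla_eval H f t = mla_eval H g t"
  using assms(1) by (induction t) (auto simp: assms(2))

theorem free_mla_universal:
  assumes H: "mult_lie_algebra H" and f: "\<And>x. x \<in> X \<Longrightarrow> f x \<in> carrier H"
  shows "\<exists>h\<in>mla_hom (free_mla X) H. \<forall>x\<in>X. h (mla_class X (TGen x)) = f x"
    and "\<lbrakk>h \<in> mla_hom (free_mla X) H; h' \<in> mla_hom (free_mla X) H;
          \<forall>x\<in>X. h (mla_class X (TGen x)) = h' (mla_class X (TGen x));
          a \<in> carrier (free_mla X)\<rbrakk> \<Longrightarrow> h a = h' a"
proof -
  interpret H: mult_lie_algebra H by fact
  interpret F: mult_lie_algebra "free_mla X" by (rule free_mla_mult_lie_algebra)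
  define f' where "f' x = (if x \<in> X then f x else \<one>\<^bsub>H\<^esub>)" for x
  have f': "f' x \<in> carrier H" for x by (simp add: f'_def f)
  define h where "h A = mla_eval H f' (SOME t. t \<in> A)" for A
  have h: "h (mla_class X t) = mla_eval H f' t" if "t \<in> mla_terms X" for t
  proof -
    have "(SOME u. u \<in> mla_class X t) \<in> mla_class X t"
      using mla_class_self [OF that] by (rule someI)
    then have "mla_eq (SOME u. u \<in> mla_class X t) t" by (simp add: mla_class_def)
    then show ?thesis unfolding h_def by (rule mla_eval_eq [OF H f'])
  qed
  have "h \<in> mla_hom (free_mla X) H"
    unfolding mla_hom_def hom_def
    by (auto simp: free_mla_simps free_mla_ops h mla_eval_closed [OF H _ f'])
  moreover have "\<forall>x\<in>X. h (mla_class X (TGen x)) = f x" by (simp add: h f'_def)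
  ultimately show "\<exists>h\<in>mla_hom (free_mla X) H. \<forall>x\<in>X. h (mla_class X (TGen x)) = f x" by blast
next
  interpret H: mult_lie_algebra H by fact
  interpret F: mult_lie_algebra "free_mla X" by (rule free_mla_mult_lie_algebra)
  assume hh: "h \<in> mla_hom (free_mla X) H" "h' \<in> mla_hom (free_mla X) H"
    and g: "\<forall>x\<in>X. h (mla_class X (TGen x)) = h' (mla_class X (TGen x))"
    and a: "a \<in> carrier (free_mla X)"
  interpret h: group_hom "free_mla X" H h
    using hh by unfold_locales (simp add: mla_hom_def)
  interpret h': group_hom "free_mla X" H h'
    using hh by unfold_locales (simp add: mla_hom_def)
  have c: "t \<in> mla_terms X \<Longrightarrow> mla_class X t \<in> carrier (free_mla X)" for t
    by (simp add: free_mla_simps)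
  have "h (mla_class X t) = h' (mla_class X t)" if "t \<in> mla_terms X" for t
    using that
  proof (induction t)
    case (TGen x)
    then show ?case using g by simp
  next
    case TOne
    then show ?case using h.hom_one h'.hom_one by (simp add: free_mla_simps)
  next
    case (TMult s t)
    then show ?case using h.hom_mult h'.hom_mult c by (simp add: free_mla_ops(1) [symmetric])
  next
    case (TInv s)
    then show ?case using h.hom_inv h'.hom_inv c by (simp add: free_mla_inv [symmetric])
  next
    case (TStar s t)
    then show ?case using hh c by (simp add: free_mla_ops(2) [symmetric] mla_hom_def)
  qed
  with a show "h a = h' a" by (auto simp: free_mla_simps)
qed

text \<open>The generators of a free multiplicative Lie algebra are pairwise distinct (map it to an abelian
  group with trivial star), so a free basis of \<open>F\<close> can be taken inside the type of \<open>F\<close>.\<close>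

definition is_free_mla :: "'f mult_lie \<Rightarrow> bool" where
  "is_free_mla F \<longleftrightarrow> mult_lie_algebra F \<and> (\<exists>X :: 'f set. mla_iso (free_mla X) F)"


section \<open>Schur multiplier, central extensions, stem covers\<close>

definition free_presentation :: "'f mult_lie \<Rightarrow> ('f \<Rightarrow> 'a) \<Rightarrow> 'a mult_lie \<Rightarrow> bool" where
  "free_presentation F \<pi> G \<longleftrightarrow>
     is_free_mla F \<and> mult_lie_algebra G \<and> \<pi> \<in> mla_hom F G \<and> \<pi> ` carrier F = carrier G"

text \<open>The Schur multiplier of \<open>G\<close> as computed from the free presentation \<open>\<pi>\<close> from \<open>F\<close> to \<open>G\<close>.\<close>

definition schur_multiplier ::
  "'f mult_lie \<Rightarrow> ('f \<Rightarrow> 'a) \<Rightarrow> 'a mult_lie \<Rightarrow> 'f set mult_lie" where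
  "schur_multiplier F \<pi> G =
     (let R = kernel F G \<pi>
      in mla_quotient (F\<lparr>carrier := M_comm F (carrier F) (carrier F) \<inter> R\<rparr>)
           (M_comm F R (carrier F)))"

definition central_extension ::
  "'e set \<Rightarrow> 'e mult_lie \<Rightarrow> ('e \<Rightarrow> 'a) \<Rightarrow> 'a mult_lie \<Rightarrow> bool" where
  "central_extension N E \<phi> G \<longleftrightarrow>
     mult_lie_algebra E \<and> mult_lie_algebra G \<and>
     \<phi> \<in> mla_hom E G \<and> \<phi> ` carrier E = carrier G \<and>
     N = kernel E G \<phi> \<and> N \<subseteq> mla_center E"

definition stem_extension ::
  "'e set \<Rightarrow> 'e mult_lie \<Rightarrow> ('e \<Rightarrow> 'a) \<Rightarrow> 'a mult_lie \<Rightarrow> bool" where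
  "stem_extension N E \<phi> G \<longleftrightarrow>
     central_extension N E \<phi> G \<and> N \<subseteq> M_comm E (carrier E) (carrier E)"

definition stem_cover ::
  "'f mult_lie \<Rightarrow> ('f \<Rightarrow> 'a) \<Rightarrow> 'e set \<Rightarrow> 'e mult_lie \<Rightarrow> ('e \<Rightarrow> 'a) \<Rightarrow> 'a mult_lie \<Rightarrow> bool" where
  "stem_cover F \<pi> N E \<phi> G \<longleftrightarrow>
     stem_extension N E \<phi> G \<and> mla_iso (E\<lparr>carrier := N\<rparr>) (schur_multiplier F \<pi> G)"

text \<open>A definition in HOL cannot quantify over the types of all central extensions of \<open>G\<close>.
  It is enough to let \<open>E\<close> range over extensions carried by sets of terms, i.e. of a type
  containing all quotients of free multiplicative Lie algebras on subsets of the type of \<open>G\<close>: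
  \<open>Z_star_subset\<close> below shows that the resulting set lies in the image of the centre of every
  central extension, of whatever type.\<close>

definition Z_star :: "'a mult_lie \<Rightarrow> 'a set" where
  "Z_star G = \<Inter> {\<phi> ` mla_center E | N (E :: 'a mla_term set mult_lie) \<phi>. central_extension N E \<phi> G}"

lemma Z_star_subset:
  fixes E :: "'e mult_lie"
  assumes ext: "central_extension N E \<phi> G"
  shows "Z_star G \<subseteq> \<phi> ` mla_center E"
proof
  fix x assume x: "x \<in> Z_star G"
  interpret E: mult_lie_algebra E using ext by (simp add: central_extension_def)
  interpret G: mult_lie_algebra G using ext by (simp add: central_extension_def)
  have hom: "\<phi> \<in> mla_hom E G" and onto: "\<phi> ` carrier E = carrier G"
    and N: "N = kernel E G \<phi>" "N \<subseteq> mla_center E"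
    using ext by (auto simp: central_extension_def)
  interpret \<phi>: group_hom E G \<phi> using hom by unfold_locales (simp add: mla_hom_def)
  have hom_star: "\<phi> (a \<star>\<^bsub>E\<^esub> b) = \<phi> a \<star>\<^bsub>G\<^esub> \<phi> b" if "a \<in> carrier E" "b \<in> carrier E" for a b
    using hom that by (simp add: mla_hom_def)
  have "\<forall>g\<in>carrier G. \<exists>e\<in>carrier E. \<phi> e = g" using onto by (metis imageE)
  then obtain s where s: "\<And>g. g \<in> carrier G \<Longrightarrow> s g \<in> carrier E \<and> \<phi> (s g) = g" by metis
  define T where "T = mla_terms (carrier G)"
  define ev where "ev = mla_eval E s"
  define S where "S = ev ` T"
  define i where "i e = {u \<in> T. ev u = e}" for e
  define j where "j A = ev (SOME u. u \<in> A)" for A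
  have ji [simp]: "j (i e) = e" if "e \<in> S" for e
  proof -
    have "\<exists>u. u \<in> i e" using that by (auto simp: S_def i_def)
    then have "(SOME u. u \<in> i e) \<in> i e" by (rule someI_ex)
    then show ?thesis by (simp add: j_def i_def)
  qed
  have S_E [simp]: "e \<in> carrier E" if "e \<in> S" for e
    using that s unfolding S_def T_def ev_def
    by (auto intro!: mla_eval_closed [OF E.mult_lie_algebra_axioms])
  have S_s [simp]: "s g \<in> S" if "g \<in> carrier G" for g
    using that unfolding S_def T_def ev_def by (intro image_eqI [of _ _ "TGen g"]) auto
  have S_one [simp]: "\<one>\<^bsub>E\<^esub> \<in> S"
    unfolding S_def T_def ev_def by (intro image_eqI [of _ _ TOne]) auto
  have S_mult [simp]: "a \<otimes>\<^bsub>E\<^esub> b \<in> S" and S_star [simp]: "a \<star>\<^bsub>E\<^esub> b \<in> S"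
    if ab: "a \<in> S" "b \<in> S" for a b
  proof -
    obtain u v where "u \<in> T" "v \<in> T" "a = ev u" "b = ev v" using ab by (auto simp: S_def)
    then show "a \<otimes>\<^bsub>E\<^esub> b \<in> S" "a \<star>\<^bsub>E\<^esub> b \<in> S"
      unfolding S_def T_def ev_def
      by (intro image_eqI [of _ _ "TMult u v"] image_eqI [of _ _ "TStar u v"]; simp)+
  qed
  have S_inv [simp]: "inv\<^bsub>E\<^esub> a \<in> S" if a: "a \<in> S" for a
  proof -
    obtain u where "u \<in> T" "a = ev u" using a by (auto simp: S_def)
    then show ?thesis
      unfolding S_def T_def ev_def by (intro image_eqI [of _ _ "TInv u"]; simp)
  qed
  have i_inj: "a = b" if "i a = i b" "a \<in> S" "b \<in> S" for a b
    using that ji by metis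
  define Q :: "'a mla_term set mult_lie" where
    "Q = \<lparr>carrier = i ` S, monoid.mult = (\<lambda>A B. i (j A \<otimes>\<^bsub>E\<^esub> j B)), one = i \<one>\<^bsub>E\<^esub>,
          star = (\<lambda>A B. i (j A \<star>\<^bsub>E\<^esub> j B))\<rparr>"
  have Q: "carrier Q = i ` S" "\<one>\<^bsub>Q\<^esub> = i \<one>\<^bsub>E\<^esub>"
    "a \<in> S \<Longrightarrow> b \<in> S \<Longrightarrow> i a \<otimes>\<^bsub>Q\<^esub> i b = i (a \<otimes>\<^bsub>E\<^esub> b)"
    "a \<in> S \<Longrightarrow> b \<in> S \<Longrightarrow> i a \<star>\<^bsub>Q\<^esub> i b = i (a \<star>\<^bsub>E\<^esub> b)" for a b
    by (simp_all add: Q_def)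
  have "group Q"
  proof (rule groupI)
    fix A assume "A \<in> carrier Q"
    then obtain a where a: "a \<in> S" "A = i a" by (auto simp: Q)
    then have "i (inv\<^bsub>E\<^esub> a) \<in> carrier Q" "i (inv\<^bsub>E\<^esub> a) \<otimes>\<^bsub>Q\<^esub> A = \<one>\<^bsub>Q\<^esub>" by (simp_all add: Q)
    then show "\<exists>B\<in>carrier Q. B \<otimes>\<^bsub>Q\<^esub> A = \<one>\<^bsub>Q\<^esub>" by blast
  qed (auto simp: Q E.m_assoc)
  then interpret Q: group Q .
  have Q_inv: "inv\<^bsub>Q\<^esub> (i a) = i (inv\<^bsub>E\<^esub> a)" if "a \<in> S" for a
    by (rule Q.inv_equality) (use that in \<open>auto simp: Q\<close>)
  have Q_conj: "conj_by Q (i a) (i b) = i (conj_by E a b)" if "a \<in> S" "b \<in> S" for a b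
    using that by (simp add: conj_by_def Q Q_inv)
  have S_conj [simp]: "conj_by E a b \<in> S" if "a \<in> S" "b \<in> S" for a b
    using that by (simp add: conj_by_def)
  have "mult_lie_algebra Q"
  proof unfold_locales
    fix A B assume "A \<in> carrier Q" "B \<in> carrier Q"
    then show "A \<star>\<^bsub>Q\<^esub> B \<in> carrier Q" by (auto simp: Q)
  next
    fix A assume "A \<in> carrier Q"
    then show "A \<star>\<^bsub>Q\<^esub> A = \<one>\<^bsub>Q\<^esub>" by (auto simp: Q E.star_self)
  next
    fix A B C assume "A \<in> carrier Q" "B \<in> carrier Q" "C \<in> carrier Q"
    then obtain a b c where *: "A = i a" "B = i b" "C = i c" "a \<in> S" "b \<in> S" "c \<in> S"
      by (auto simp: Q)
    show "A \<star>\<^bsub>Q\<^esub> (B \<otimes>\<^bsub>Q\<^esub> C) = (A \<star>\<^bsub>Q\<^esub> B) \<otimes>\<^bsub>Q\<^esub> conj_by Q B (A \<star>\<^bsub>Q\<^esub> C)"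
      by (simp add: * Q Q_conj E.star_mult_right)
    show "(A \<otimes>\<^bsub>Q\<^esub> B) \<star>\<^bsub>Q\<^esub> C = conj_by Q A (B \<star>\<^bsub>Q\<^esub> C) \<otimes>\<^bsub>Q\<^esub> (A \<star>\<^bsub>Q\<^esub> C)"
      by (simp add: * Q Q_conj E.star_mult_left)
    show "((A \<star>\<^bsub>Q\<^esub> B) \<star>\<^bsub>Q\<^esub> conj_by Q B C) \<otimes>\<^bsub>Q\<^esub> ((B \<star>\<^bsub>Q\<^esub> C) \<star>\<^bsub>Q\<^esub> conj_by Q C A)
        \<otimes>\<^bsub>Q\<^esub> ((C \<star>\<^bsub>Q\<^esub> A) \<star>\<^bsub>Q\<^esub> conj_by Q A B) = \<one>\<^bsub>Q\<^esub>"
      by (simp add: * Q Q_conj E.star_jacobi)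
    show "conj_by Q C (A \<star>\<^bsub>Q\<^esub> B) = conj_by Q C A \<star>\<^bsub>Q\<^esub> conj_by Q C B"
      by (simp add: * Q Q_conj E.star_conj)
  qed
  moreover have "(\<phi> \<circ> j) \<in> mla_hom Q G"
    by (auto simp: mla_hom_def hom_def Q hom_star)
  moreover have "(\<phi> \<circ> j) ` carrier Q = carrier G"
  proof
    show "carrier G \<subseteq> (\<phi> \<circ> j) ` carrier Q"
    proof
      fix g assume "g \<in> carrier G"
      then show "g \<in> (\<phi> \<circ> j) ` carrier Q"
        using s by (intro image_eqI [of _ _ "i (s g)"]) (auto simp: Q)
    qed
  qed (auto simp: Q)
  moreover have "kernel Q G (\<phi> \<circ> j) \<subseteq> mla_center Q"
  proof
    fix A assume "A \<in> kernel Q G (\<phi> \<circ> j)"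
    then obtain a where a: "A = i a" "a \<in> S" "\<phi> a = \<one>\<^bsub>G\<^esub>" by (auto simp: kernel_def Q)
    then have "a \<in> mla_center E" using N by (auto simp: kernel_def)
    then show "A \<in> mla_center Q"
      using a by (auto simp: mla_center_def lie_center_def group_center_def Q)
  qed
  ultimately have "central_extension (kernel Q G (\<phi> \<circ> j)) Q (\<phi> \<circ> j) G"
    using G.mult_lie_algebra_axioms by (simp add: central_extension_def)
  with x have "x \<in> (\<phi> \<circ> j) ` mla_center Q" unfolding Z_star_def by blast
  then obtain A where A: "A \<in> mla_center Q" "x = \<phi> (j A)" by auto
  then have "A \<in> carrier Q" by (simp add: mla_center_def lie_center_def)
  then obtain e where e: "e \<in> S" "A = i e" by (auto simp: Q)
  have comm: "e \<otimes>\<^bsub>E\<^esub> f = f \<otimes>\<^bsub>E\<^esub> e" and triv: "e \<star>\<^bsub>E\<^esub> f = \<one>\<^bsub>E\<^esub>" if "f \<in> S" for f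
  proof -
    have "i (e \<otimes>\<^bsub>E\<^esub> f) = i (f \<otimes>\<^bsub>E\<^esub> e)" "i (e \<star>\<^bsub>E\<^esub> f) = i \<one>\<^bsub>E\<^esub>"
      using A(1) e that by (auto simp: mla_center_def lie_center_def group_center_def Q)
    then show "e \<otimes>\<^bsub>E\<^esub> f = f \<otimes>\<^bsub>E\<^esub> e" "e \<star>\<^bsub>E\<^esub> f = \<one>\<^bsub>E\<^esub>"
      using e that by (auto intro: i_inj)
  qed
  have "e \<otimes>\<^bsub>E\<^esub> f = f \<otimes>\<^bsub>E\<^esub> e \<and> e \<star>\<^bsub>E\<^esub> f = \<one>\<^bsub>E\<^esub>" if f: "f \<in> carrier E" for f
  proof -
    define f' where "f' = s (\<phi> f)"
    define n where "n = inv\<^bsub>E\<^esub> f' \<otimes>\<^bsub>E\<^esub> f"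
    have f': "f' \<in> S" "\<phi> f' = \<phi> f" using f s by (auto simp: f'_def)
    have "n \<in> kernel E G \<phi>" using f f' by (simp add: n_def kernel_def)
    then have n: "n \<in> carrier E" "\<And>y. y \<in> carrier E \<Longrightarrow> n \<otimes>\<^bsub>E\<^esub> y = y \<otimes>\<^bsub>E\<^esub> n"
      "\<And>y. y \<in> carrier E \<Longrightarrow> n \<star>\<^bsub>E\<^esub> y = \<one>\<^bsub>E\<^esub>"
      using N by (auto simp: mla_center_def lie_center_def group_center_def)
    have fn: "f = f' \<otimes>\<^bsub>E\<^esub> n" using f f' by (simp add: n_def E.m_assoc [symmetric])
    have eE [simp]: "e \<in> carrier E" and [simp]: "f' \<in> carrier E" using e f' by simp_all
    have en [simp]: "e \<star>\<^bsub>E\<^esub> n \<in> carrier E" using n by (simp add: E.star_closed)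
    have "\<one>\<^bsub>E\<^esub> = (e \<otimes>\<^bsub>E\<^esub> n) \<star>\<^bsub>E\<^esub> (e \<otimes>\<^bsub>E\<^esub> n)" using n(1) by (simp add: E.star_self)
    also have "\<dots> = e \<star>\<^bsub>E\<^esub> (e \<otimes>\<^bsub>E\<^esub> n)"
      using n(1) n(3) by (simp add: E.star_mult_left conj_by_def E.star_closed)
    also have "\<dots> = conj_by E e (e \<star>\<^bsub>E\<^esub> n)"
      using n(1) by (simp add: E.star_mult_right E.star_self conj_by_def)
    finally have "e \<otimes>\<^bsub>E\<^esub> (e \<star>\<^bsub>E\<^esub> n) \<otimes>\<^bsub>E\<^esub> inv\<^bsub>E\<^esub> e = \<one>\<^bsub>E\<^esub>"
      by (simp add: conj_by_def)
    then have "e \<otimes>\<^bsub>E\<^esub> (e \<star>\<^bsub>E\<^esub> n) = e"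
      using E.inv_equality [of "e \<otimes>\<^bsub>E\<^esub> (e \<star>\<^bsub>E\<^esub> n)" "inv\<^bsub>E\<^esub> e"] by simp
    then have 1: "e \<star>\<^bsub>E\<^esub> n = \<one>\<^bsub>E\<^esub>" by simp
    have "e \<star>\<^bsub>E\<^esub> f = \<one>\<^bsub>E\<^esub>"
      using n(1) f' by (simp add: fn E.star_mult_right 1 triv conj_by_def)
    moreover have "e \<otimes>\<^bsub>E\<^esub> f = f \<otimes>\<^bsub>E\<^esub> e"
    proof -
      have "e \<otimes>\<^bsub>E\<^esub> f = (e \<otimes>\<^bsub>E\<^esub> f') \<otimes>\<^bsub>E\<^esub> n" using n(1) by (simp add: fn E.m_assoc)
      also have "\<dots> = f' \<otimes>\<^bsub>E\<^esub> (e \<otimes>\<^bsub>E\<^esub> n)" using n(1) f' comm [of f'] by (simp add: E.m_assoc)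
      also have "\<dots> = f' \<otimes>\<^bsub>E\<^esub> (n \<otimes>\<^bsub>E\<^esub> e)" using n(2) [OF eE] by simp
      also have "\<dots> = f \<otimes>\<^bsub>E\<^esub> e" using n(1) by (simp add: fn E.m_assoc)
      finally show ?thesis .
    qed
    ultimately show ?thesis by simp
  qed
  then have "e \<in> mla_center E"
    using e by (simp add: mla_center_def lie_center_def group_center_def)
  with A e show "x \<in> \<phi> ` mla_center E" by simp
qed

end

theory Submission
  imports Defs
begin

text \<open>Write \<open>[A,B]\<close> for \<open>M_comm\<close>. Lift a free presentation \<open>\<pi> : F \<rightarrow> G\<close> with kernel \<open>R\<close> along a
  central extension \<open>\<phi> : E \<rightarrow> G\<close> to \<open>\<theta> : F \<rightarrow> E\<close>. Then \<open>\<theta>\<close> kills \<open>[R,F]\<close>, and \<open>E\<close> is generated by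
  \<open>\<theta>(F)\<close> and a central subgroup; hence \<open>\<theta>(f)\<close> is central whenever all stars and commutators of
  \<open>f\<close> lie in \<open>[R,F]\<close>. For a stem cover \<open>\<theta>\<close> is onto and induces a surjection from the Schur
  multiplier \<open>([F,F] \<inter> R) / [R,F]\<close> onto \<open>N\<close>, which is injective because both sides are finite of
  the same cardinality. So \<open>[F,F] \<inter> ker \<theta> = [R,F]\<close>, and a lift to \<open>F\<close> of a central element of the
  cover has all its stars and commutators in \<open>[R,F]\<close>, so its image is central in every central
  extension.\<close>

section \<open>Homomorphisms and inverses of isomorphisms\<close>

lemma mla_homD:
  assumes "h \<in> mla_hom G H"
  shows "h \<in> hom G H"
    and "x \<in> carrier G \<Longrightarrow> y \<in> carrier G \<Longrightarrow> h (x \<star>\<^bsub>G\<^esub> y) = h x \<star>\<^bsub>H\<^esub> h y"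
  using assms by (auto simp: mla_hom_def)

lemma mla_hom_group_hom:
  assumes "mult_lie_algebra G" "mult_lie_algebra H" "h \<in> mla_hom G H"
  shows "group_hom G H h"
  using assms by (auto simp: group_hom_def group_hom_axioms_def mult_lie_algebra_def mla_hom_def)

lemma mla_hom_compose:
  assumes "mult_lie_algebra G" "h \<in> mla_hom G H" "k \<in> mla_hom H K"
  shows "k \<circ> h \<in> mla_hom G K"
  using assms unfolding mla_hom_def hom_def by (auto simp: Pi_iff)

text \<open>\<open>is_free_mla\<close> provides an isomorphism from the term model to
  \<open>F\<close>; lifting a presentation needs a map out of \<open>F\<close>, hence the
  inverse.\<close>

lemma mla_hom_inv_into:
  assumes G: "mult_lie_algebra G" and h: "h \<in> mla_hom G H"
    and bij: "bij_betw h (carrier G) (carrier H)"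
  shows "inv_into (carrier G) h \<in> mla_hom H G"
proof -
  interpret G: mult_lie_algebra G by fact
  let ?k = "inv_into (carrier G) h"
  have k: "?k y \<in> carrier G" "h (?k y) = y" if "y \<in> carrier H" for y
    using bij that by (auto simp: bij_betw_def inv_into_into f_inv_into_f)
  have inj: "x = y" if "h x = h y" "x \<in> carrier G" "y \<in> carrier G" for x y
    using bij that by (auto simp: bij_betw_def inj_on_def)
  have cl: "h x \<in> carrier H" if "x \<in> carrier G" for x
    using bij that by (auto simp: bij_betw_def)
  have hm: "h (x \<otimes>\<^bsub>G\<^esub> y) = h x \<otimes>\<^bsub>H\<^esub> h y" if "x \<in> carrier G" "y \<in> carrier G" for x y
    using h that by (simp add: mla_hom_def hom_mult)
  have mult: "?k (x \<otimes>\<^bsub>H\<^esub> y) = ?k x \<otimes>\<^bsub>G\<^esub> ?k y" if "x \<in> carrier H" "y \<in> carrier H" for x y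
  proof -
    have "x \<otimes>\<^bsub>H\<^esub> y = h (?k x \<otimes>\<^bsub>G\<^esub> ?k y)" using that by (simp add: k hm)
    with bij that k show ?thesis by (simp add: bij_betw_def)
  qed
  have star: "?k (x \<star>\<^bsub>H\<^esub> y) = ?k x \<star>\<^bsub>G\<^esub> ?k y" if "x \<in> carrier H" "y \<in> carrier H" for x y
  proof -
    have "x \<star>\<^bsub>H\<^esub> y = h (?k x \<star>\<^bsub>G\<^esub> ?k y)" using that by (simp add: k mla_homD(2) [OF h])
    with bij that k show ?thesis by (simp add: bij_betw_def G.star_closed)
  qed
  show ?thesis by (auto simp: mla_hom_def hom_def k mult star)
qed

section \<open>Calculus with central elements\<close>

context mult_lie_algebra
begin

lemma mla_centerD:
  assumes "n \<in> mla_center G"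
  shows "n \<in> carrier G"
    and "x \<in> carrier G \<Longrightarrow> n \<otimes> x = x \<otimes> n"
    and "x \<in> carrier G \<Longrightarrow> n \<star> x = \<one>"
  using assms by (auto simp: mla_center_def lie_center_def group_center_def)

lemma conj_by_central:
  assumes "n \<in> mla_center G" "x \<in> carrier G"
  shows "conj_by G n x = x"
  using assms by (simp add: conj_by_def mla_centerD(1) mla_centerD(2) [of n x] m_assoc)

text \<open>\<open>lie_center\<close> only gives \<open>n \<star> x = \<one>\<close>. The other side
  follows by expanding \<open>(n \<otimes> x) \<star> (n \<otimes> x) = \<one>\<close> with both
  distributive laws: all that survives is \<open>x \<star> n\<close>.\<close>

lemma star_central_right:
  assumes n: "n \<in> mla_center G" and x: "x \<in> carrier G"
  shows "x \<star> n = \<one>"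
proof -
  note [simp] = mla_centerD(1) [OF n] x
  have xn: "x \<star> n \<in> carrier G" by (simp add: star_closed)
  have "(n \<otimes> x) \<star> (n \<otimes> x) = x \<star> (n \<otimes> x)"
    by (simp add: star_mult_left conj_by_central [OF n] mla_centerD(3) [OF n] star_closed)
  also have "\<dots> = x \<star> n"
    by (simp add: star_mult_right star_self conj_by_central [OF n] xn)
  finally show ?thesis by (simp add: star_self)
qed

text \<open>The distributive laws split off stars with a central entry, which vanish, and
  conjugation by a central element is trivial. So stars depend only on the arguments modulo the
  centre.\<close>

lemma star_central_factors:
  assumes "n \<in> mla_center G" "m \<in> mla_center G" "x \<in> carrier G" "y \<in> carrier G"
  shows "(n \<otimes> x) \<star> (m \<otimes> y) = x \<star> y"
  using assms
  by (simp add: star_mult_left star_mult_right star_central_right conj_by_central mla_centerD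
      star_closed)

lemma commutator_central_left:
  assumes "n \<in> mla_center G" "x \<in> carrier G"
  shows "commutator G n x = \<one>"
  using assms by (simp add: commutator_def mla_centerD(1) mla_centerD(2) [of n x] m_assoc)

lemma commutator_central_factors:
  assumes n: "n \<in> mla_center G" and m: "m \<in> mla_center G"
    and x: "x \<in> carrier G" and y: "y \<in> carrier G"
  shows "commutator G (n \<otimes> x) (m \<otimes> y) = commutator G x y"
proof -
  note [simp] = mla_centerD(1) [OF n] mla_centerD(1) [OF m] x y
  have nz: "n \<otimes> z = z \<otimes> n" and mz: "m \<otimes> z = z \<otimes> m" if "z \<in> carrier G" for z
    using that mla_centerD(2) n m by auto
  \<comment> \<open>\<open>n\<close> commutes with the conjugate standing between \<open>n\<close>
    and \<open>inv n\<close>, so these two cancel. Then \<open>m\<close> is pulled out of the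
    conjugate by \<open>x\<close> and cancels against \<open>inv m\<close>.\<close>
  have "commutator G (n \<otimes> x) (m \<otimes> y) = n \<otimes> (x \<otimes> (m \<otimes> y) \<otimes> inv x) \<otimes> inv n \<otimes> inv (m \<otimes> y)"
    by (simp add: commutator_def inv_mult_group m_assoc)
  also have "\<dots> = x \<otimes> (m \<otimes> y) \<otimes> inv x \<otimes> inv (m \<otimes> y)"
    by (subst nz) (simp_all add: m_assoc)
  also have "\<dots> = m \<otimes> (x \<otimes> y \<otimes> inv x) \<otimes> inv (m \<otimes> y)"
  proof -
    have "x \<otimes> (m \<otimes> y) = m \<otimes> (x \<otimes> y)" using mz [of x] by (simp add: m_assoc [symmetric])
    then show ?thesis by (simp add: m_assoc)
  qed
  also have "\<dots> = x \<otimes> y \<otimes> inv x \<otimes> inv y"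
  proof -
    have "inv (m \<otimes> y) = inv m \<otimes> inv y" using mz [of y] by (simp add: inv_mult_group)
    moreover have "m \<otimes> (inv m \<otimes> inv y) = inv y" by (simp add: m_assoc [symmetric])
    ultimately show ?thesis using mz [of "x \<otimes> y \<otimes> inv x"] by (simp add: m_assoc)
  qed
  finally show ?thesis by (simp add: commutator_def)
qed

lemma commutator_closed:
  "\<lbrakk>x \<in> carrier G; y \<in> carrier G\<rbrakk> \<Longrightarrow> commutator G x y \<in> carrier G"
  by (simp add: commutator_def)

lemma commutator_eq_one_iff:
  assumes "x \<in> carrier G" "y \<in> carrier G"
  shows "commutator G x y = \<one> \<longleftrightarrow> x \<otimes> y = y \<otimes> x"
proof -
  have "commutator G x y = (x \<otimes> y) \<otimes> inv (y \<otimes> x)"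
    using assms by (simp add: commutator_def inv_mult_group m_assoc)
  then show ?thesis
    using assms by (metis inv_closed m_closed right_cancel r_inv)
qed

text \<open>Centrality is expressed through stars and commutators, the two kinds of generators of
  \<open>M_comm\<close>, so that it can be tested inside \<open>F\<close>.\<close>

lemma mla_centerI:
  assumes "x \<in> carrier G" "\<And>y. y \<in> carrier G \<Longrightarrow> x \<star> y = \<one>"
    "\<And>y. y \<in> carrier G \<Longrightarrow> commutator G x y = \<one>"
  shows "x \<in> mla_center G"
  using assms by (auto simp: mla_center_def lie_center_def group_center_def commutator_eq_one_iff)

section \<open>Membership in [A,B], and its triviality for central A\<close>

lemma star_commutator_carrier:
  assumes "A \<subseteq> carrier G" "B \<subseteq> carrier G"
  shows "{a \<star> b | a b. a \<in> A \<and> b \<in> B} \<subseteq> carrier G"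
    and "{commutator G a b | a b. a \<in> A \<and> b \<in> B} \<subseteq> carrier G"
  using assms by (auto simp: star_closed commutator_closed subset_iff)

lemma star_in_M_comm:
  assumes "a \<in> A" "b \<in> B" "a \<in> carrier G" "b \<in> carrier G"
  shows "a \<star> b \<in> M_comm G A B"
proof -
  have "a \<star> b \<in> star_subgroup G A B"
    using assms unfolding star_subgroup_def by (blast intro: generate.incl)
  moreover have "\<one> \<in> comm_subgroup G A B" by (simp add: comm_subgroup_def generate.one)
  moreover have "a \<star> b = (a \<star> b) \<otimes> \<one>" using assms by (simp add: star_closed)
  ultimately show ?thesis unfolding M_comm_def set_mult_def by blast
qed

lemma commutator_in_M_comm:
  assumes "a \<in> A" "b \<in> B" "a \<in> carrier G" "b \<in> carrier G"
  shows "commutator G a b \<in> M_comm G A B"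
proof -
  have "commutator G a b \<in> comm_subgroup G A B"
    using assms unfolding comm_subgroup_def by (blast intro: generate.incl)
  moreover have "\<one> \<in> star_subgroup G A B" by (simp add: star_subgroup_def generate.one)
  moreover have "commutator G a b = \<one> \<otimes> commutator G a b"
    using assms by (simp add: commutator_closed)
  ultimately show ?thesis unfolding M_comm_def set_mult_def by blast
qed

lemma one_in_M_comm: "\<one> \<in> M_comm G A B"
proof -
  have "\<one> \<in> star_subgroup G A B" "\<one> \<in> comm_subgroup G A B"
    by (simp_all add: star_subgroup_def comm_subgroup_def generate.one)
  moreover have "\<one> = \<one> \<otimes> \<one>" by simp
  ultimately show ?thesis unfolding M_comm_def set_mult_def by blast
qed

lemma M_comm_carrier:
  assumes "A \<subseteq> carrier G" "B \<subseteq> carrier G"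
  shows "M_comm G A B \<subseteq> carrier G"
  unfolding M_comm_def star_subgroup_def comm_subgroup_def
  by (intro set_mult_closed generate_incl star_commutator_carrier assms)

text \<open>All generating stars and commutators equal \<open>\<one>\<close>. Applied to the image
  of [R,F] in a central extension.\<close>

lemma M_comm_central:
  assumes "A \<subseteq> mla_center G" "B \<subseteq> carrier G"
  shows "M_comm G A B = {\<one>}"
proof -
  have "generate G K = {\<one>}" if "K \<subseteq> {\<one>}" for K
    using that generate_one generate_empty by (auto simp: subset_singleton_iff)
  moreover have "{a \<star> b | a b. a \<in> A \<and> b \<in> B} \<subseteq> {\<one>}"
    "{commutator G a b | a b. a \<in> A \<and> b \<in> B} \<subseteq> {\<one>}"
    using assms by (auto simp: commutator_central_left mla_centerD(3) subset_iff)
  ultimately show ?thesis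
    by (simp add: M_comm_def star_subgroup_def comm_subgroup_def set_mult_def)
qed

end

section \<open>Images of [A,B] and lifts of free presentations\<close>

lemma mla_hom_commutator:
  assumes "mult_lie_algebra G" "mult_lie_algebra H" "h \<in> mla_hom G H"
    "x \<in> carrier G" "y \<in> carrier G"
  shows "h (commutator G x y) = commutator H (h x) (h y)"
proof -
  interpret group_hom G H h using assms(1-3) by (rule mla_hom_group_hom)
  show ?thesis using assms(4,5) by (simp add: commutator_def)
qed

text \<open>A homomorphism maps generators onto the corresponding generators, and taking images
  commutes with generating a subgroup and with set products.\<close>

lemma mla_hom_M_comm:
  assumes G: "mult_lie_algebra G" and H: "mult_lie_algebra H" and h: "h \<in> mla_hom G H"
    and A: "A \<subseteq> carrier G" and B: "B \<subseteq> carrier G"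
  shows "h ` M_comm G A B = M_comm H (h ` A) (h ` B)"
proof -
  interpret G: mult_lie_algebra G by fact
  interpret h: group_hom G H h using G H h by (rule mla_hom_group_hom)
  have star: "h ` {a \<star>\<^bsub>G\<^esub> b | a b. a \<in> A \<and> b \<in> B} = {a \<star>\<^bsub>H\<^esub> b | a b. a \<in> h ` A \<and> b \<in> h ` B}"
  proof -
    have "h (a \<star>\<^bsub>G\<^esub> b) = h a \<star>\<^bsub>H\<^esub> h b" if "a \<in> A" "b \<in> B" for a b
      using that A B by (auto intro: mla_homD(2) [OF h])
    then show ?thesis by (auto simp: image_iff) metis+
  qed
  have comm: "h ` {commutator G a b | a b. a \<in> A \<and> b \<in> B}
      = {commutator H a b | a b. a \<in> h ` A \<and> b \<in> h ` B}"
  proof -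
    have "h (commutator G a b) = commutator H (h a) (h b)" if "a \<in> A" "b \<in> B" for a b
      using that A B by (auto intro: mla_hom_commutator [OF G H h])
    then show ?thesis by (auto simp: image_iff) metis+
  qed
  have mult: "h ` (S <#>\<^bsub>G\<^esub> T) = h ` S <#>\<^bsub>H\<^esub> h ` T"
    if "S \<subseteq> carrier G" "T \<subseteq> carrier G" for S T
  proof -
    have "h (s \<otimes>\<^bsub>G\<^esub> t) = h s \<otimes>\<^bsub>H\<^esub> h t" if "s \<in> S" "t \<in> T" for s t
      by (rule h.hom_mult) (use that \<open>S \<subseteq> carrier G\<close> \<open>T \<subseteq> carrier G\<close> in blast)+
    then show ?thesis by (simp add: set_mult_def image_UN)
  qed
  note cl = G.star_commutator_carrier [OF A B]
  show ?thesis
    unfolding M_comm_def star_subgroup_def comm_subgroup_def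
    by (simp add: mult G.generate_incl cl h.generate_img [symmetric] star comm)
qed

text \<open>Projectivity of free objects: choose preimages under \<open>\<phi>\<close> of the images
  of the generators and extend by the universal property.\<close>

lemma free_presentation_lift:
  assumes pres: "free_presentation F \<pi> G" and E: "mult_lie_algebra E"
    and \<phi>: "\<phi> \<in> mla_hom E G" and onto: "\<phi> ` carrier E = carrier G"
  shows "\<exists>\<theta>\<in>mla_hom F E. \<forall>x\<in>carrier F. \<phi> (\<theta> x) = \<pi> x"
proof -
  have G: "mult_lie_algebra G" and \<pi>: "\<pi> \<in> mla_hom F G" and "is_free_mla F"
    using pres by (auto simp: free_presentation_def)
  then obtain X :: "'a set" and h where h: "h \<in> mla_hom (free_mla X) F"
      and bij: "bij_betw h (carrier (free_mla X)) (carrier F)"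
    by (auto simp: is_free_mla_def mla_iso_def)
  let ?F = "free_mla X"
  let ?g = "\<lambda>x. mla_class X (TGen x)"
  have F: "mult_lie_algebra ?F" by (rule free_mla_mult_lie_algebra)
  have \<pi>h: "\<pi> \<circ> h \<in> mla_hom ?F G" using F h \<pi> by (rule mla_hom_compose)
  have g: "?g x \<in> carrier ?F" if "x \<in> X" for x using that by (simp add: free_mla_carrierI)
  have \<pi>hc: "(\<pi> \<circ> h) x \<in> carrier G" if "x \<in> carrier ?F" for x
    using hom_in_carrier [OF mla_homD(1) [OF \<pi>h] that] .
  have "\<exists>e\<in>carrier E. \<phi> e = (\<pi> \<circ> h) (?g x)" if "x \<in> X" for x
    using \<pi>hc [OF g [OF that]] onto by (metis imageE)
  then obtain s where s: "\<And>x. x \<in> X \<Longrightarrow> s x \<in> carrier E \<and> \<phi> (s x) = (\<pi> \<circ> h) (?g x)" by metis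
  obtain k where k: "k \<in> mla_hom ?F E" "\<forall>x\<in>X. k (?g x) = s x"
    using free_mla_universal(1) [OF E, of X s] s by blast
  \<comment> \<open>Both composites agree on the generators, so the uniqueness half of the universal
    property applies.\<close>
  have "(\<phi> \<circ> k) a = (\<pi> \<circ> h) a" if "a \<in> carrier ?F" for a
  proof (rule free_mla_universal(2) [OF G _ _ \<pi>h _ that])
    show "\<phi> \<circ> k \<in> mla_hom ?F G" using F k(1) \<phi> by (rule mla_hom_compose)
    show "\<forall>x\<in>X. (\<phi> \<circ> k) (?g x) = (\<pi> \<circ> h) (?g x)" using k s by simp
    show "(\<pi> \<circ> h) (?g x) \<in> carrier G" if "x \<in> X" for x using \<pi>hc g that by simp
  qed
  then have lift: "\<phi> (k (inv_into (carrier ?F) h x)) = \<pi> x" if "x \<in> carrier F" for x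
    using bij that by (simp add: bij_betw_def inv_into_into f_inv_into_f)
  have "k \<circ> inv_into (carrier ?F) h \<in> mla_hom F E"
    using \<open>is_free_mla F\<close> mla_hom_inv_into [OF F h bij] k(1)
    by (auto simp: is_free_mla_def intro: mla_hom_compose)
  with lift show ?thesis by (intro bexI [of _ "k \<circ> inv_into (carrier ?F) h"]) auto
qed

section \<open>Lifts of a presentation to a central extension\<close>

text \<open>The final argument interprets this twice over the same presentation: for the stem cover
  and for an arbitrary central extension.\<close>

locale central_lift =
  fixes F :: "'f mult_lie" and \<pi> :: "'f \<Rightarrow> 'a" and G :: "'a mult_lie"
    and N :: "'e set" and E :: "'e mult_lie" and \<phi> :: "'e \<Rightarrow> 'a" and \<theta> :: "'f \<Rightarrow> 'e"
  assumes pres: "free_presentation F \<pi> G"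
    and ext: "central_extension N E \<phi> G"
    and hom: "\<theta> \<in> mla_hom F E"
    and lift: "x \<in> carrier F \<Longrightarrow> \<phi> (\<theta> x) = \<pi> x"
begin

sublocale F: mult_lie_algebra F
  using pres by (simp add: free_presentation_def is_free_mla_def)

sublocale E: mult_lie_algebra E using ext by (simp add: central_extension_def)

sublocale G: mult_lie_algebra G using ext by (simp add: central_extension_def)

sublocale \<theta>: group_hom F E \<theta>
  using F.mult_lie_algebra_axioms E.mult_lie_algebra_axioms hom by (rule mla_hom_group_hom)

sublocale \<phi>: group_hom E G \<phi>
  using E.mult_lie_algebra_axioms G.mult_lie_algebra_axioms ext
  by (auto simp: central_extension_def intro: mla_hom_group_hom)

abbreviation R where "R \<equiv> kernel F G \<pi>"

lemma kernel_central: "N = kernel E G \<phi>" "N \<subseteq> mla_center E"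
  using ext by (auto simp: central_extension_def)

text \<open>If \<open>\<phi> e = \<pi> x\<close>, then \<open>e\<close> and
  \<open>\<theta> x\<close> have the same image in \<open>G\<close> and differ by an element of the
  central kernel \<open>N\<close>.\<close>

lemma decompose:
  assumes e: "e \<in> carrier E"
  obtains n x where "n \<in> N" "n \<in> mla_center E" "x \<in> carrier F" "e = n \<otimes>\<^bsub>E\<^esub> \<theta> x"
proof -
  have "\<phi> e \<in> \<pi> ` carrier F" using e pres by (simp add: free_presentation_def)
  then obtain x where x: "x \<in> carrier F" "\<phi> e = \<pi> x" by blast
  let ?n = "e \<otimes>\<^bsub>E\<^esub> inv\<^bsub>E\<^esub> \<theta> x"
  have "?n \<in> N" using e x(1) by (simp add: kernel_central(1) kernel_def lift flip: x(2))
  moreover have "e = ?n \<otimes>\<^bsub>E\<^esub> \<theta> x" using e x by (simp add: E.m_assoc)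
  ultimately show ?thesis using kernel_central(2) x(1) that by blast
qed

lemma hom_R: "\<theta> ` R \<subseteq> N"
  by (auto simp: kernel_central(1) kernel_def lift)

text \<open>\<open>\<theta>\<close> maps \<open>R\<close> into the central subgroup
  \<open>N\<close>, so the image of [R,F] is generated by trivial elements.\<close>

lemma hom_M_comm_R:
  assumes "f \<in> M_comm F R (carrier F)"
  shows "\<theta> f = \<one>\<^bsub>E\<^esub>"
proof -
  have "R \<subseteq> carrier F" by (auto simp: kernel_def)
  then have "\<theta> ` M_comm F R (carrier F) = M_comm E (\<theta> ` R) (\<theta> ` carrier F)"
    using F.mult_lie_algebra_axioms E.mult_lie_algebra_axioms hom by (intro mla_hom_M_comm) auto
  also have "\<dots> = {\<one>\<^bsub>E\<^esub>}"
    using hom_R kernel_central(2) by (intro E.M_comm_central) auto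
  finally show ?thesis using assms by blast
qed

text \<open>Every element of \<open>E\<close> is some \<open>\<theta> x\<close> up to a central
  factor, which stars and commutators ignore; what remains is the image of an element of
  [R,F].\<close>

lemma central_if:
  assumes f: "f \<in> carrier F"
    and star: "\<And>y. y \<in> carrier F \<Longrightarrow> f \<star>\<^bsub>F\<^esub> y \<in> M_comm F R (carrier F)"
    and comm: "\<And>y. y \<in> carrier F \<Longrightarrow> commutator F f y \<in> M_comm F R (carrier F)"
  shows "\<theta> f \<in> mla_center E"
proof (rule E.mla_centerI)
  have "\<one>\<^bsub>E\<^esub> \<in> N" by (simp add: kernel_central(1) kernel_def)
  then have one: "\<one>\<^bsub>E\<^esub> \<in> mla_center E" using kernel_central(2) by blast
  fix e assume "e \<in> carrier E"
  then obtain n x where n: "n \<in> mla_center E" and x: "x \<in> carrier F" and e: "e = n \<otimes>\<^bsub>E\<^esub> \<theta> x"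
    by (rule decompose)
  \<comment> \<open>\<open>one\<close> serves as the central factor in front of
    \<open>\<theta> f\<close>, since the lemma expects one in each argument.\<close>
  have "\<theta> f \<star>\<^bsub>E\<^esub> e = \<theta> f \<star>\<^bsub>E\<^esub> \<theta> x"
    using E.star_central_factors [OF one n, of "\<theta> f" "\<theta> x"] f x by (simp add: e)
  also have "\<dots> = \<theta> (f \<star>\<^bsub>F\<^esub> x)" using f x by (simp add: mla_homD(2) [OF hom])
  finally show "\<theta> f \<star>\<^bsub>E\<^esub> e = \<one>\<^bsub>E\<^esub>" using star x by (simp add: hom_M_comm_R)
  have "commutator E (\<theta> f) e = commutator E (\<theta> f) (\<theta> x)"
    using E.commutator_central_factors [OF one n, of "\<theta> f" "\<theta> x"] f x by (simp add: e)
  also have "\<dots> = \<theta> (commutator F f x)" using f x by (simp add: commutator_def)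
  finally show "commutator E (\<theta> f) e = \<one>\<^bsub>E\<^esub>" using comm x by (simp add: hom_M_comm_R)
qed (use f in simp)

text \<open>By \<open>decompose\<close>, the stars and commutators of \<open>E\<close> are already
  those of the image of \<open>\<theta>\<close>, whether or not \<open>\<theta>\<close> is
  onto.\<close>

lemma M_comm_image:
  "M_comm E (carrier E) (carrier E) = \<theta> ` M_comm F (carrier F) (carrier F)"
proof -
  let ?T = "\<theta> ` carrier F"
  have star: "{a \<star>\<^bsub>E\<^esub> b | a b. a \<in> carrier E \<and> b \<in> carrier E} = {a \<star>\<^bsub>E\<^esub> b | a b. a \<in> ?T \<and> b \<in> ?T}"
    and comm: "{commutator E a b | a b. a \<in> carrier E \<and> b \<in> carrier E}
      = {commutator E a b | a b. a \<in> ?T \<and> b \<in> ?T}"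
  proof -
    have "\<exists>a'\<in>?T. \<exists>b'\<in>?T. a \<star>\<^bsub>E\<^esub> b = a' \<star>\<^bsub>E\<^esub> b' \<and> commutator E a b = commutator E a' b'"
      if ab: "a \<in> carrier E" "b \<in> carrier E" for a b
    proof -
      obtain n x where n: "n \<in> mla_center E" "x \<in> carrier F" "a = n \<otimes>\<^bsub>E\<^esub> \<theta> x"
        using ab(1) by (rule decompose)
      obtain m y where m: "m \<in> mla_center E" "y \<in> carrier F" "b = m \<otimes>\<^bsub>E\<^esub> \<theta> y"
        using ab(2) by (rule decompose)
      show ?thesis
        using n m by (intro bexI [of _ "\<theta> x"] bexI [of _ "\<theta> y"])
          (auto simp: E.star_central_factors E.commutator_central_factors)
    qed
    moreover have "?T \<subseteq> carrier E" by auto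
    ultimately show
      "{a \<star>\<^bsub>E\<^esub> b | a b. a \<in> carrier E \<and> b \<in> carrier E} = {a \<star>\<^bsub>E\<^esub> b | a b. a \<in> ?T \<and> b \<in> ?T}"
      "{commutator E a b | a b. a \<in> carrier E \<and> b \<in> carrier E}
        = {commutator E a b | a b. a \<in> ?T \<and> b \<in> ?T}"
      by blast+
  qed
  have "M_comm E (carrier E) (carrier E) = M_comm E ?T ?T"
    unfolding M_comm_def star_subgroup_def comm_subgroup_def star comm ..
  also have "\<dots> = \<theta> ` M_comm F (carrier F) (carrier F)"
    using F.mult_lie_algebra_axioms E.mult_lie_algebra_axioms hom
    by (intro mla_hom_M_comm [symmetric]) auto
  finally show ?thesis .
qed

section \<open>Stem extensions and stem covers\<close>

lemma M_comm_F_carrier: "M_comm F (carrier F) (carrier F) \<subseteq> carrier F"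
  by (rule F.M_comm_carrier) auto

text \<open>The factor from \<open>N\<close> in \<open>decompose\<close> lies in [E,E], which is the
  image of [F,F]; so both factors come from \<open>F\<close>.\<close>

lemma stem_onto:
  assumes "N \<subseteq> M_comm E (carrier E) (carrier E)"
  shows "\<theta> ` carrier F = carrier E"
proof (intro subset_antisym subsetI)
  fix e assume "e \<in> carrier E"
  then obtain n x where n: "n \<in> N" "x \<in> carrier F" "e = n \<otimes>\<^bsub>E\<^esub> \<theta> x"
    by (rule decompose)
  obtain m where m: "m \<in> carrier F" "n = \<theta> m"
    using assms n(1) M_comm_F_carrier by (auto simp: M_comm_image)
  with n have "e = \<theta> (m \<otimes>\<^bsub>F\<^esub> x)" by simp
  then show "e \<in> \<theta> ` carrier F" using m n by blast
qed auto

text \<open>An element of \<open>N\<close> lifts to some \<open>m\<close> in [F,F], and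
  \<open>\<pi> m = \<phi> (\<theta> m) = \<one>\<close> puts \<open>m\<close> into
  \<open>R\<close>.\<close>

lemma stem_image:
  assumes "N \<subseteq> M_comm E (carrier E) (carrier E)"
  shows "\<theta> ` (M_comm F (carrier F) (carrier F) \<inter> R) = N"
proof (intro subset_antisym subsetI)
  fix n assume n: "n \<in> N"
  then obtain m where m: "m \<in> M_comm F (carrier F) (carrier F)" "n = \<theta> m"
    using assms by (auto simp: M_comm_image)
  moreover have "m \<in> R"
    using m n M_comm_F_carrier lift by (auto simp: kernel_central(1) kernel_def)
  ultimately show "n \<in> \<theta> ` (M_comm F (carrier F) (carrier F) \<inter> R)" by blast
qed (use hom_R in blast)

text \<open>\<open>\<theta>\<close> induces a surjection from the Schur multiplier onto
  \<open>N\<close>. The isomorphism in \<open>stem_cover\<close> makes the two finite sets equally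
  large, so the surjection is injective and \<open>f\<close> lies in the trivial coset.\<close>

lemma stem_cover_kernel:
  assumes cover: "stem_cover F \<pi> N E \<phi> G"
    and fin: "finite (carrier (schur_multiplier F \<pi> G))"
    and f: "f \<in> M_comm F (carrier F) (carrier F)" and f1: "\<theta> f = \<one>\<^bsub>E\<^esub>"
  shows "f \<in> M_comm F R (carrier F)"
proof -
  let ?K = "M_comm F (carrier F) (carrier F) \<inter> R" and ?H = "M_comm F R (carrier F)"
  have stem: "N \<subseteq> M_comm E (carrier E) (carrier E)"
    using cover by (simp add: stem_cover_def stem_extension_def)
  define C where "C = (\<lambda>a. ?H #>\<^bsub>F\<^esub> a) ` ?K"
  \<comment> \<open>Restricting the carrier leaves the multiplication unchanged, so the cosets may
    be formed in \<open>F\<close>.\<close>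
  have "carrier (schur_multiplier F \<pi> G) = C"
    by (auto simp: C_def schur_multiplier_def mla_quotient_def Let_def RCOSETS_def r_coset_def)
  with fin cover have C: "finite C" and "\<exists>h. bij_betw h N C"
    by (auto simp: stem_cover_def mla_iso_def)
  then have card: "card N = card C" using bij_betw_same_card by blast
  have K: "a \<in> carrier F" if "a \<in> ?K" for a using that by (simp add: kernel_def)
  have H: "?H \<subseteq> carrier F" by (rule F.M_comm_carrier) (auto simp: kernel_def)
  \<comment> \<open>The induced map on cosets; \<open>the_elem\<close> is meaningful because
    \<open>\<theta>\<close> is constant on each coset in \<open>C\<close>.\<close>
  define t where "t c = the_elem (\<theta> ` c)" for c
  have t: "t (?H #>\<^bsub>F\<^esub> a) = \<theta> a" if "a \<in> ?K" for a
  proof -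
    have "\<theta> (h \<otimes>\<^bsub>F\<^esub> a) = \<theta> a" if "h \<in> ?H" for h
      using that H K [OF \<open>a \<in> ?K\<close>] by (simp add: subset_iff hom_M_comm_R)
    then have "(\<Union>h\<in>?H. {\<theta> (h \<otimes>\<^bsub>F\<^esub> a)}) = {\<theta> a}"
      using F.one_in_M_comm by auto
    then have "\<theta> ` (?H #>\<^bsub>F\<^esub> a) = {\<theta> a}"
      by (simp add: r_coset_def image_UN)
    then show ?thesis by (simp add: t_def)
  qed
  have "t ` C = \<theta> ` ?K" by (simp add: C_def image_image t cong: image_cong_simp)
  then have inj: "inj_on t C"
    using C card by (intro eq_card_imp_inj_on) (simp_all add: stem_image [OF stem])
  have fF: "f \<in> carrier F" using f M_comm_F_carrier by blast
  have fK: "f \<in> ?K"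
    using f fF f1 lift [OF fF] by (simp add: kernel_def \<phi>.hom_one)
  have oneK: "\<one>\<^bsub>F\<^esub> \<in> ?K"
    using F.one_in_M_comm lift [of "\<one>\<^bsub>F\<^esub>"] by (simp add: kernel_def)
  \<comment> \<open>\<open>t\<close> sends both cosets to the identity of \<open>E\<close>.\<close>
  have "?H #>\<^bsub>F\<^esub> f = ?H #>\<^bsub>F\<^esub> \<one>\<^bsub>F\<^esub>"
    by (rule inj_onD [OF inj]) (use fK oneK f1 in \<open>auto simp: t C_def\<close>)
  also have "\<dots> = ?H" using H by (rule F.coset_mult_one)
  moreover have "f \<in> ?H #>\<^bsub>F\<^esub> f"
    using F.one_in_M_comm fF by (force simp: r_coset_def)
  ultimately show ?thesis by simp
qed

end

section \<open>Comparison of the cover with all central extensions\<close>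

lemma central_lift_exists:
  assumes "free_presentation F \<pi> G" "central_extension N E \<phi> G"
  shows "\<exists>\<theta>. central_lift F \<pi> G N E \<phi> \<theta>"
  using free_presentation_lift [of F \<pi> G E \<phi>] assms
  by (auto simp: central_lift_def central_extension_def)

theorem theorem4p18:
  fixes G :: "'a mult_lie"
    and F :: "'f mult_lie" and \<pi> :: "'f \<Rightarrow> 'a"
    and N :: "'e set" and Gstar :: "'e mult_lie" and \<phi> :: "'e \<Rightarrow> 'a"
  assumes "mult_lie_algebra G"
    and "free_presentation F \<pi> G"
    and "finite (carrier (schur_multiplier F \<pi> G))"
    and "stem_cover F \<pi> N Gstar \<phi> G"
  shows "Z_star G = \<phi> ` mla_center Gstar"
proof
  have ext: "central_extension N Gstar \<phi> G"
    and stem: "N \<subseteq> M_comm Gstar (carrier Gstar) (carrier Gstar)"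
    using assms(4) by (auto simp: stem_cover_def stem_extension_def)
  \<comment> \<open>\<open>Z_star\<close> intersects over extensions carried by sets of terms;
    \<open>Z_star_subset\<close> passes to the type of \<open>Gstar\<close>.\<close>
  from ext show "Z_star G \<subseteq> \<phi> ` mla_center Gstar" by (rule Z_star_subset)
  obtain \<theta> where "central_lift F \<pi> G N Gstar \<phi> \<theta>"
    using central_lift_exists [OF assms(2) ext] by blast
  then interpret S: central_lift F \<pi> G N Gstar \<phi> \<theta> .
  show "\<phi> ` mla_center Gstar \<subseteq> Z_star G"
  proof
    fix x assume "x \<in> \<phi> ` mla_center Gstar"
    then obtain g where g: "g \<in> mla_center Gstar" "x = \<phi> g" by blast
    then have "g \<in> \<theta> ` carrier F" by (simp add: S.stem_onto [OF stem] S.E.mla_centerD)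
    then obtain f where f: "f \<in> carrier F" "g = \<theta> f" by blast
    \<comment> \<open>These elements lie in [F,F], and \<open>\<theta>\<close> kills them because
      \<open>g\<close> is central; \<open>stem_cover_kernel\<close> then places them in
      [R,F].\<close>
    have star: "f \<star>\<^bsub>F\<^esub> y \<in> M_comm F (kernel F G \<pi>) (carrier F)"
      and comm: "commutator F f y \<in> M_comm F (kernel F G \<pi>) (carrier F)"
      if y: "y \<in> carrier F" for y
    proof -
      show "f \<star>\<^bsub>F\<^esub> y \<in> M_comm F (kernel F G \<pi>) (carrier F)"
      proof (rule S.stem_cover_kernel [OF assms(4,3)])
        show "f \<star>\<^bsub>F\<^esub> y \<in> M_comm F (carrier F) (carrier F)"
          using f y by (simp add: S.F.star_in_M_comm)
        show "\<theta> (f \<star>\<^bsub>F\<^esub> y) = \<one>\<^bsub>Gstar\<^esub>"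
          using f y g by (simp add: mla_homD(2) [OF S.hom] S.E.mla_centerD(3))
      qed
      show "commutator F f y \<in> M_comm F (kernel F G \<pi>) (carrier F)"
      proof (rule S.stem_cover_kernel [OF assms(4,3)])
        show "commutator F f y \<in> M_comm F (carrier F) (carrier F)"
          using f y by (simp add: S.F.commutator_in_M_comm)
        have "\<theta> (commutator F f y) = commutator Gstar (\<theta> f) (\<theta> y)"
          using f y by (simp add: commutator_def)
        then show "\<theta> (commutator F f y) = \<one>\<^bsub>Gstar\<^esub>"
          using f y g by (simp add: S.E.commutator_central_left)
      qed
    qed
    show "x \<in> Z_star G"
      unfolding Z_star_def
    proof clarify
      fix M and E :: "'a mla_term set mult_lie" and \<psi>
      assume E: "central_extension M E \<psi> G"
      then obtain \<eta> where "central_lift F \<pi> G M E \<psi> \<eta>"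
        using central_lift_exists [OF assms(2) E] by blast
      then interpret T: central_lift F \<pi> G M E \<psi> \<eta> .
      \<comment> \<open>The facts about \<open>f\<close> concern \<open>F\<close> alone, so the same
        \<open>f\<close> works for every extension; \<open>x = \<pi> f\<close> is its image through
        either lift.\<close>
      have "\<eta> f \<in> mla_center E" using f(1) star comm by (rule T.central_if)
      moreover have "x = \<psi> (\<eta> f)" using f g by (simp add: S.lift T.lift)
      ultimately show "x \<in> \<psi> ` mla_center E" by blast
    qed
  qed
qed

end
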